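(* For integers $k\ge 2$, $m\ge k$ and $b$ with $k-2\le b$ (and additionally $b\le \frac{km-4k+4}{k-2}$ when $k\ge 3$) such that $k(m-b)$ is even, define $$f(k,m,b)(q)=\binom{m}{k}_q-q^{\frac{k(m-b)}{2}+b-2k+2}\binom{b}{k-2}_q .$$ Then: (i) If $k=2$, then $f(2,m,b)$ is nonnegative and unimodal if and only if $m$ is even. (ii) If $k=3$ (so $m\ge 3$, $1\le b\le 3m-8$, $b\equiv m \pmod 2$), then $f(3,m,b)$ is nonnegative and unimodal if and only if $b\ne 3m-10$ and moreover: $b\ne 2$ if $m$ is even; $b\ne 1$ and $b\neq 5$ if $m\equiv 1\pmod 4$; and $b\ne 3$ if $m\equiv 3\pmod 4$. (iii) If $k=4$ (so $m\ge 4$, $2\le b\le 2m-6$), then $f(4,m,b)$ is nonnegative and unimodal if and only if $b$ is even and $m\ne 5$.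
   Context: For integers $m\ge k\ge 0$ the $q$-binomial coefficient is $\binom{m}{k}_q=\prod_{i=1}^{m}(1-q^i)\big/\big(\prod_{i=1}^{k}(1-q^i)\prod_{i=1}^{m-k}(1-q^i)\big)$, a polynomial in $q$ of degree $k(m-k)$. A polynomial is nonnegative if all its coefficients are $\ge 0$, and unimodal if its coefficient sequence weakly increases up to some index and weakly decreases afterwards. Note $f(k,m,b)$ is symmetric about degree $k(m-k)/2$. *)

theory Defs
  imports Complex_Main "HOL-Computational_Algebra.Polynomial"
begin

definition qfact_poly :: "nat \<Rightarrow> int poly" where
  "qfact_poly n = (\<Prod>i=1..n. 1 - monom 1 i)"

text \<open>
  The operation \<open>div\<close> on integer polynomials is the exact quotient whenever the divisor
  divides the dividend; \<open>qbinomial_exact\<close> below shows that this is the case here.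
\<close>

definition qbinomial :: "nat \<Rightarrow> nat \<Rightarrow> int poly" where
  "qbinomial m k = qfact_poly m div (qfact_poly k * qfact_poly (m - k))"

definition nonnegative_poly :: "int poly \<Rightarrow> bool" where
  "nonnegative_poly p \<longleftrightarrow> (\<forall>i. 0 \<le> coeff p i)"

text \<open>
  The coefficient sequence of \<open>p\<close> is the finite sequence with indices up to \<open>degree p\<close>.
\<close>

definition unimodal_poly :: "int poly \<Rightarrow> bool" where
  "unimodal_poly p \<longleftrightarrow>
     (\<exists>n\<le>degree p. (\<forall>i<n. coeff p i \<le> coeff p (Suc i)) \<and>
                   (\<forall>i. n \<le> i \<and> i < degree p \<longrightarrow> coeff p (Suc i) \<le> coeff p i))"

text \<open>
  The exponent is computed in \<open>int\<close> because \<open>m - b\<close> may be negative.  For admissible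
  parameters the division by 2 is exact and the exponent is nonnegative
  (\<open>f_exponent_nonneg\<close>), so that \<open>nat\<close> loses nothing.
\<close>

definition f_exponent :: "nat \<Rightarrow> nat \<Rightarrow> nat \<Rightarrow> int" where
  "f_exponent k m b = int k * (int m - int b) div 2 + int b - 2 * int k + 2"

definition f_poly :: "nat \<Rightarrow> nat \<Rightarrow> nat \<Rightarrow> int poly" where
  "f_poly k m b = qbinomial m k - monom 1 (nat (f_exponent k m b)) * qbinomial b (k - 2)"

definition admissible :: "nat \<Rightarrow> nat \<Rightarrow> nat \<Rightarrow> bool" where
  "admissible k m b \<longleftrightarrow>
     2 \<le> k \<and> k \<le> m \<and> int k - 2 \<le> int b \<and>
     (3 \<le> k \<longrightarrow> real b \<le> (real k * real m - 4 * real k + 4) / (real k - 2)) \<and>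
     even (int k * (int m - int b))"

lemma qfact_poly_0 [simp]: "qfact_poly 0 = 1"
  by (simp add: qfact_poly_def)

lemma qfact_poly_Suc: "qfact_poly (Suc n) = qfact_poly n * (1 - monom 1 (Suc n))"
  by (simp add: qfact_poly_def)

lemma qfact_poly_nonzero: "qfact_poly n \<noteq> 0"
proof -
  have "1 - monom 1 i \<noteq> (0 :: int poly)" if "i \<ge> 1" for i
  proof
    assume "1 - monom 1 i = (0 :: int poly)"
    then have "coeff (1 - monom 1 i) 0 = (0 :: int)" by simp
    with that show False by simp
  qed
  then show ?thesis by (auto simp: qfact_poly_def)
qed

lemma qfact_poly_dvd: "qfact_poly k * qfact_poly l dvd qfact_poly (k + l)"
proof (induction "k + l" arbitrary: k l)
  case 0
  then show ?case by simp
next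
  case (Suc n)
  show ?case
  proof (cases "k = 0 \<or> l = 0")
    case True
    then show ?thesis by auto
  next
    case False
    then obtain k' l' where kl: "k = Suc k'" "l = Suc l'"
      by (metis not0_implies_Suc)
    have n: "n = k' + l" "n = k + l'" using Suc(2) kl by auto
    have A: "qfact_poly k * qfact_poly l dvd qfact_poly n * (1 - monom 1 k)"
      using mult_dvd_mono[OF Suc(1)[OF n(1)] dvd_refl[of "1 - monom 1 k"]]
      by (simp only: n(1) kl(1) qfact_poly_Suc mult_ac)
    have B: "qfact_poly k * qfact_poly l dvd qfact_poly n * (1 - monom 1 l)"
      using mult_dvd_mono[OF Suc(1)[OF n(2)] dvd_refl[of "1 - monom 1 l"]]
      by (simp only: n(2) kl(2) qfact_poly_Suc mult_ac)
    have "(monom 1 (k + l) :: int poly) = monom 1 k * monom 1 l"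
      by (simp add: mult_monom)
    then have "qfact_poly (k + l) =
        qfact_poly n * (1 - monom 1 k) + monom 1 k * (qfact_poly n * (1 - monom 1 l))"
      by (simp only: Suc(2)[symmetric] qfact_poly_Suc) (simp add: algebra_simps)
    then show ?thesis using A B by (simp add: dvd_add)
  qed
qed

lemma qbinomial_exact:
  assumes "k \<le> m"
  shows "qbinomial m k * (qfact_poly k * qfact_poly (m - k)) = qfact_poly m"
  using qfact_poly_dvd[of k "m - k"] assms by (simp add: qbinomial_def)

lemma f_exponent_nonneg:
  assumes "admissible k m b"
  shows "0 \<le> f_exponent k m b"
    and "2 * f_exponent k m b = int k * (int m - int b) + 2 * int b - 4 * int k + 4"
proof -
  show eq: "2 * f_exponent k m b = int k * (int m - int b) + 2 * int b - 4 * int k + 4"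
    using assms by (auto simp: f_exponent_def admissible_def)
  show "0 \<le> f_exponent k m b"
  proof (cases "k = 2")
    case True
    then show ?thesis using assms by (simp add: f_exponent_def admissible_def)
  next
    case False
    then have "real b * (real k - 2) \<le> real k * real m - 4 * real k + 4"
      using assms by (simp add: admissible_def pos_le_divide_eq)
    then have "real_of_int (int b * (int k - 2)) \<le> real_of_int (int k * int m - 4 * int k + 4)"
      by simp
    then have "int b * (int k - 2) \<le> int k * int m - 4 * int k + 4"
      by (simp only: of_int_le_iff)
    then show ?thesis using eq by (simp add: algebra_simps)
  qed
qed

end

theory Submission
  imports Defs "HOL-Computational_Algebra.Polynomial_FPS"
begin

text \<open>
  Since \<open>f(k,m,b)\<close> is symmetric about \<open>k(m-k)/2\<close>, it is nonnegative and unimodal iff the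
  coefficients of \<open>(1-q) f(k,m,b)\<close> up to that degree are nonnegative.  In this range only the
  terms of \<open>(1-q^(m-k+1)) ... (1-q^m)\<close> that are constant or of degree about \<open>m\<close> contribute, so for
  \<open>k = 2, 3, 4\<close> the coefficients of \<open>(1-q) (m choose k)_q\<close> are \<open>[i even]\<close>,
  \<open>p_23(i) - p_12(i-m+2)\<close> and \<open>p_234(i) - p_123(i-m+3)\<close>, where \<open>p_S\<close> counts partitions with parts
  in \<open>S\<close>.  For \<open>k = 4\<close> the identity \<open>p_234(2j) = p_123(j) = p_234(2j+3)\<close> reduces everything to
  the monotonicity of \<open>p_123\<close>; for \<open>k = 3\<close> the subtracted polynomial contributes a single \<open>-1\<close>,
  and the closed formula for \<open>p_23\<close> tells where it hits a zero coefficient.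
\<close>

section \<open>Palindromic polynomials and the first-difference criterion\<close>

text \<open>\<open>N\<close> is twice the centre of symmetry and need not be the degree: the
  subtraction in \<open>f_poly\<close> can cancel the extreme coefficients, and for
  \<open>k = m = 2\<close> it even gives 0.\<close>

definition palindromic :: "nat \<Rightarrow> int poly \<Rightarrow> bool" where
  "palindromic N p \<longleftrightarrow> (\<forall>i. coeff p i = (if i \<le> N then coeff p (N - i) else 0))"

lemma palindromic_coeff_reflect: "palindromic N p \<Longrightarrow> i \<le> N \<Longrightarrow> coeff p (N - i) = coeff p i"
  and palindromic_coeff_zero: "palindromic N p \<Longrightarrow> N < i \<Longrightarrow> coeff p i = 0"
  unfolding palindromic_def by (metis, metis not_le)

lemma palindromic_diff:
  assumes "palindromic N p" "palindromic N r"
  shows "palindromic N (p - r)"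
  unfolding palindromic_def
  by (simp add: palindromic_coeff_reflect[OF assms(1)] palindromic_coeff_reflect[OF assms(2)]
      palindromic_coeff_zero[OF assms(1)] palindromic_coeff_zero[OF assms(2)])

lemma palindromic_monom_mult:
  assumes "palindromic M p" "N = 2 * e + M"
  shows "palindromic N (monom 1 e * p)"
  unfolding palindromic_def
proof
  fix i
  consider "i < e" | "e \<le> i" "i \<le> e + M" | "e + M < i" "i \<le> N" | "N < i" by linarith
  then show "coeff (monom 1 e * p) i = (if i \<le> N then coeff (monom 1 e * p) (N - i) else 0)"
  proof cases
    case 1
    then show ?thesis
      using assms palindromic_coeff_zero[OF assms(1), of "N - i - e"] by (simp add: coeff_monom_mult)
  next
    case 2
    then have "N - i - e = M - (i - e)" "e \<le> N - i" "i \<le> N" "i - e \<le> M" using assms(2) by auto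
    with 2 show ?thesis
      using palindromic_coeff_reflect[OF assms(1), of "i - e"] by (simp add: coeff_monom_mult)
  next
    case 3
    then show ?thesis
      using assms palindromic_coeff_zero[OF assms(1), of "i - e"] by (auto simp: coeff_monom_mult)
  next
    case 4
    then show ?thesis
      using assms palindromic_coeff_zero[OF assms(1), of "i - e"] by (auto simp: coeff_monom_mult)
  qed
qed

lemma coeff_one_minus_q_mult:
  fixes p :: "int poly"
  shows "coeff ((1 - monom 1 (Suc 0)) * p) i = coeff p i - (if i = 0 then 0 else coeff p (i - 1))"
  by (simp add: left_diff_distrib coeff_monom_mult)

text \<open>Reflection exchanges rises below the middle with descents above it. So even if the peak
  lies left of the middle, every rise up to the middle follows from a descent beyond the peak;
  conversely, rises from a nonnegative constant term determine the whole shape.\<close>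

lemma palindromic_nonneg_unimodal_iff:
  assumes pal: "palindromic N p"
  shows "nonnegative_poly p \<and> unimodal_poly p \<longleftrightarrow>
    (\<forall>i. 2 * i \<le> N \<longrightarrow> 0 \<le> coeff ((1 - monom 1 1) * p) i)"
proof (intro iffI conjI allI impI)
  fix i
  assume nu: "nonnegative_poly p \<and> unimodal_poly p" and i: "2 * i \<le> N"
  from nu have nn: "0 \<le> coeff p j" for j by (simp add: nonnegative_poly_def)
  from nu obtain n where n: "\<And>i. i < n \<Longrightarrow> coeff p i \<le> coeff p (Suc i)"
      "\<And>i. n \<le> i \<Longrightarrow> i < degree p \<Longrightarrow> coeff p (Suc i) \<le> coeff p i"
    unfolding unimodal_poly_def by blast
  \<comment> \<open>Nonnegativity gives the descent from the leading coefficient to 0, which removes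
    the bound by the degree.\<close>
  have n': "coeff p (Suc i) \<le> coeff p i" if "n \<le> i" for i
    using n(2)[OF that] nn[of i] by (cases "i < degree p") (auto simp: coeff_eq_0)
  show "0 \<le> coeff ((1 - monom 1 1) * p) i"
  proof (cases i)
    case 0
    then show ?thesis using nn by (simp add: coeff_one_minus_q_mult)
  next
    case (Suc j)
    have "coeff p j \<le> coeff p (Suc j)"
    proof (cases "j < n")
      case True
      then show ?thesis by (rule n(1))
    next
      case False
      \<comment> \<open>As \<open>Suc j\<close> is at most N/2, the reflected index
        \<open>N - Suc j\<close> is at least \<open>j\<close> and so past the peak.\<close>
      then have "coeff p (Suc (N - Suc j)) \<le> coeff p (N - Suc j)" using i Suc by (intro n') auto
      moreover have "Suc (N - Suc j) = N - j" using i Suc by auto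
      ultimately show ?thesis
        using palindromic_coeff_reflect[OF pal, of j] palindromic_coeff_reflect[OF pal, of "Suc j"]
          i Suc by simp
    qed
    then show ?thesis using Suc by (simp add: coeff_one_minus_q_mult)
  qed
next
  assume R: "\<forall>i. 2 * i \<le> N \<longrightarrow> 0 \<le> coeff ((1 - monom 1 1) * p) i"
  have inc: "coeff p i \<le> coeff p (Suc i)" if "2 * Suc i \<le> N" for i
    using R[rule_format, OF that] by (simp add: coeff_one_minus_q_mult)
  have dec: "coeff p (Suc i) \<le> coeff p i" if "N \<le> 2 * i + 1" for i
  proof -
    \<comment> \<open>Apart from reflected rises, the descents are the two equal middle coefficients
      for odd \<open>N\<close> and the drop to 0 after index \<open>N\<close>.\<close>
    consider "N = 2 * i + 1" | "N = i" | "i < N" "N \<le> 2 * i" | "N < i"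
      using \<open>N \<le> 2 * i + 1\<close> by linarith
    then show ?thesis
    proof cases
      case 1
      then have "N - i = Suc i" by simp
      then show ?thesis using palindromic_coeff_reflect[OF pal, of i] 1 by simp
    next
      case 2
      have "0 \<le> coeff p 0" using R[rule_format, of 0] by (simp add: coeff_one_minus_q_mult)
      then show ?thesis
        using palindromic_coeff_reflect[OF pal, of 0] palindromic_coeff_zero[OF pal, of "Suc i"] 2
        by simp
    next
      case 3
      then have "coeff p (N - Suc i) \<le> coeff p (Suc (N - Suc i))" by (intro inc) auto
      moreover have "Suc (N - Suc i) = N - i" using 3 by auto
      ultimately show ?thesis
        using palindromic_coeff_reflect[OF pal, of i] palindromic_coeff_reflect[OF pal, of "Suc i"] 3
        by simp
    next
      case 4
      then show ?thesis by (simp add: palindromic_coeff_zero[OF pal])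
    qed
  qed
  have low: "0 \<le> coeff p i" if "2 * i \<le> N" for i
    using that
  proof (induction i)
    case 0
    then show ?case using R[rule_format, of 0] by (simp add: coeff_one_minus_q_mult)
  next
    case (Suc i)
    then show ?case using inc[of i] by simp
  qed
  show "nonnegative_poly p"
    unfolding nonnegative_poly_def
  proof
    fix i
    consider "2 * i \<le> N" | "i \<le> N" "2 * (N - i) \<le> N" | "N < i" by linarith
    then show "0 \<le> coeff p i"
    proof cases
      case 2
      then show ?thesis using low[of "N - i"] palindromic_coeff_reflect[OF pal, of i] by simp
    qed (simp_all add: low palindromic_coeff_zero[OF pal])
  qed
  show "unimodal_poly p"
    unfolding unimodal_poly_def
    \<comment> \<open>A nonzero palindromic polynomial has degree at least N/2, so the minimum can
      differ from \<open>N div 2\<close> only for the zero polynomial.\<close>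
    by (rule exI[of _ "min (N div 2) (degree p)"]) (auto intro!: inc dec)
qed

section \<open>Symmetry of the q-binomials and of f\<close>

lemma reflect_poly_one_minus_monom:
  assumes "0 < n"
  shows "reflect_poly (1 - monom 1 n :: int poly) = - (1 - monom 1 n)"
    and "degree (1 - monom 1 n :: int poly) = n"
proof -
  have "degree (monom 1 n - 1 :: int poly) = n"
    using assms by (intro antisym degree_le le_degree) (auto simp: coeff_eq_0 degree_monom_eq)
  then show deg: "degree (1 - monom 1 n :: int poly) = n"
    by (metis degree_minus minus_diff_eq)
  show "reflect_poly (1 - monom 1 n :: int poly) = - (1 - monom 1 n)"
  proof (rule poly_eqI)
    fix i
    show "coeff (reflect_poly (1 - monom 1 n :: int poly)) i = coeff (- (1 - monom 1 n)) i"
      unfolding coeff_reflect_poly deg using assms by (auto simp: coeff_eq_0)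
  qed
qed

lemma reflect_poly_qfact: "reflect_poly (qfact_poly n) = (- 1) ^ n * qfact_poly n"
proof (induction n)
  case (Suc n)
  then show ?case
    unfolding qfact_poly_Suc reflect_poly_mult reflect_poly_one_minus_monom(1)[OF zero_less_Suc]
    by (simp add: algebra_simps)
qed simp

lemma degree_qfact: "2 * degree (qfact_poly n) = n * (n + 1)"
proof (induction n)
  case (Suc n)
  have "1 - monom 1 (Suc n) \<noteq> (0 :: int poly)"
    using qfact_poly_nonzero[of "Suc n"] by (auto simp: qfact_poly_Suc)
  then have "degree (qfact_poly (Suc n)) = degree (qfact_poly n) + Suc n"
    unfolding qfact_poly_Suc
    by (simp add: degree_mult_eq qfact_poly_nonzero reflect_poly_one_minus_monom)
  with Suc show ?case by simp
qed simp

lemma qbinomial_nonzero: "k \<le> m \<Longrightarrow> qbinomial m k \<noteq> 0"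
  using qbinomial_exact[of k m] qfact_poly_nonzero[of m] by auto

lemma degree_qbinomial:
  assumes "k \<le> m"
  shows "degree (qbinomial m k) = k * (m - k)"
proof -
  obtain l where m: "m = k + l" using assms le_Suc_ex by blast
  have "degree (qbinomial m k) + (degree (qfact_poly k) + degree (qfact_poly l)) = degree (qfact_poly m)"
    unfolding qbinomial_exact[OF assms, symmetric]
    by (simp add: degree_mult_eq qbinomial_nonzero qfact_poly_nonzero assms m)
  then have "2 * degree (qbinomial m k) + k * (k + 1) + l * (l + 1) = m * (m + 1)"
    using degree_qfact[of k] degree_qfact[of l] degree_qfact[of m] by linarith
  then show ?thesis by (simp add: m algebra_simps)
qed

text \<open>Reversal is multiplicative and negates each factor \<open>1 - q^i\<close>. Numerator and
  denominator both have \<open>m\<close> such factors, so the signs cancel.\<close>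

lemma reflect_poly_qbinomial:
  assumes "k \<le> m"
  shows "reflect_poly (qbinomial m k) = qbinomial m k"
proof -
  define D where "D = qfact_poly k * qfact_poly (m - k)"
  have D: "D \<noteq> 0" by (simp add: D_def qfact_poly_nonzero)
  have sgn: "(- 1 :: int poly) ^ k * (- 1) ^ (m - k) = (- 1) ^ m"
    using assms by (simp flip: power_add)
  have "reflect_poly D = (- 1) ^ m * D"
    by (simp add: D_def reflect_poly_mult reflect_poly_qfact flip: sgn)
  then have "reflect_poly (qbinomial m k) * ((- 1) ^ m * D) = (- 1) ^ m * (qbinomial m k * D)"
    using arg_cong[OF qbinomial_exact[OF assms], of reflect_poly] qbinomial_exact[OF assms]
    by (simp add: reflect_poly_mult reflect_poly_qfact D_def[symmetric])
  with D show ?thesis by simp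
qed

lemma palindromic_qbinomial:
  assumes "k \<le> m"
  shows "palindromic (k * (m - k)) (qbinomial m k)"
  unfolding palindromic_def
  using coeff_reflect_poly[of "qbinomial m k", unfolded reflect_poly_qbinomial[OF assms]
      degree_qbinomial[OF assms]]
  by (metis not_less)

text \<open>The exponent e of f is chosen to give both terms the same centre: 2e + (k-2)(b-k+2) =
  k(m-k).\<close>

lemma palindromic_f_poly:
  assumes adm: "admissible k m b"
  shows "palindromic (k * (m - k)) (f_poly k m b)"
proof -
  have k: "k \<le> m" "k - 2 \<le> b" "2 \<le> k" using adm by (auto simp: admissible_def)
  \<comment> \<open>Writing the parameters as sums removes the truncated subtractions from the
    degree identity.\<close>
  then obtain j l c where "m = k + l" "k = j + 2" "b = j + c"
    by (metis add.commute le_add_diff_inverse)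
  then have "int (k * (m - k)) = int (2 * nat (f_exponent k m b) + (k - 2) * (b - (k - 2)))"
    using f_exponent_nonneg[OF adm] by (simp add: algebra_simps)
  then have "k * (m - k) = 2 * nat (f_exponent k m b) + (k - 2) * (b - (k - 2))"
    by (simp only: of_nat_eq_iff)
  then show ?thesis
    unfolding f_poly_def
    by (intro palindromic_diff palindromic_qbinomial k(1)
        palindromic_monom_mult[OF palindromic_qbinomial[OF k(2)]])
qed

section \<open>First differences of q-binomials as power series\<close>

definition qbinomial_step :: "nat \<Rightarrow> nat \<Rightarrow> nat \<Rightarrow> int" where
  "qbinomial_step m k i = coeff ((1 - monom 1 1) * qbinomial m k) i"

lemma f_poly_nonneg_unimodal_iff:
  assumes adm: "admissible k m b" and e: "f_exponent k m b = int e"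
  shows "nonnegative_poly (f_poly k m b) \<and> unimodal_poly (f_poly k m b) \<longleftrightarrow>
    (\<forall>i. 2 * i \<le> k * (m - k) \<longrightarrow>
      (if e \<le> i then qbinomial_step b (k - 2) (i - e) else 0) \<le> qbinomial_step m k i)"
proof -
  have *: "(1 - monom 1 1) * f_poly k m b =
      (1 - monom 1 1) * qbinomial m k - monom 1 e * ((1 - monom 1 1) * qbinomial b (k - 2))"
    by (simp add: f_poly_def e algebra_simps)
  show ?thesis
    unfolding palindromic_nonneg_unimodal_iff[OF palindromic_f_poly[OF adm]] *
      coeff_diff coeff_monom_mult qbinomial_step_def[symmetric]
    by (rule all_cong1) (auto simp: not_less)
qed

text \<open>For positive lower index, \<open>1 - q\<close> cancels the first factor of the
  denominator. The remaining factors stay on the left, to be removed later by multiplying with the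
  generating functions that are their inverses.\<close>

lemma fps_one_minus_q_qbinomial:
  fixes n :: nat
  defines "B \<equiv> \<lambda>m k. fps_of_poly ((1 - monom 1 1) * qbinomial m k)"
  shows "B n 0 = 1 - fps_X"
    and "B (n + 1) 1 = 1 - fps_X ^ (n + 1)"
    and "B (n + 2) 2 * (1 - fps_X ^ 2) = (1 - fps_X ^ (n + 1)) * (1 - fps_X ^ (n + 2))"
    and "B (n + 3) 3 * ((1 - fps_X ^ 2) * (1 - fps_X ^ 3)) =
      (1 - fps_X ^ (n + 1)) * (1 - fps_X ^ (n + 2)) * (1 - fps_X ^ (n + 3))"
    and "B (n + 4) 4 * ((1 - fps_X ^ 2) * (1 - fps_X ^ 3) * (1 - fps_X ^ 4)) =
      (1 - fps_X ^ (n + 1)) * (1 - fps_X ^ (n + 2)) * (1 - fps_X ^ (n + 3)) * (1 - fps_X ^ (n + 4))"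
proof -
  let ?F = "\<lambda>n. fps_of_poly (qfact_poly n)"
  have nz: "?F n \<noteq> 0" by (simp add: qfact_poly_nonzero)
  have S: "?F (Suc n) = ?F n * (1 - fps_X ^ Suc n)" for n
    by (simp add: qfact_poly_Suc fps_of_poly_mult fps_of_poly_diff fps_of_poly_monom)
  have ex: "fps_of_poly (qbinomial (n + k) k) * (?F k * ?F n) = ?F (n + k)" for k
    using qbinomial_exact[of k "n + k"] by (simp flip: fps_of_poly_mult)
  have B: "B m k = fps_of_poly (qbinomial m k) * (1 - fps_X)" for m k
    by (simp add: B_def fps_of_poly_mult fps_of_poly_diff fps_of_poly_monom)
  have cancel: "u = v" if "u * ?F n = v * ?F n" for u v
    using that nz by simp
  show "B n 0 = 1 - fps_X"
    unfolding B using ex[of 0] nz by simp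
  show "B (n + 1) 1 = 1 - fps_X ^ (n + 1)"
    by (rule cancel, unfold B, insert ex[of 1])
      (simp add: S numeral_eq_Suc mult_ac del: power_Suc)
  show "B (n + 2) 2 * (1 - fps_X ^ 2) = (1 - fps_X ^ (n + 1)) * (1 - fps_X ^ (n + 2))"
    by (rule cancel, unfold B, insert ex[of 2])
      (simp add: S numeral_eq_Suc mult_ac del: power_Suc)
  show "B (n + 3) 3 * ((1 - fps_X ^ 2) * (1 - fps_X ^ 3)) =
      (1 - fps_X ^ (n + 1)) * (1 - fps_X ^ (n + 2)) * (1 - fps_X ^ (n + 3))"
    by (rule cancel, unfold B, insert ex[of 3])
      (simp add: S numeral_eq_Suc mult_ac del: power_Suc)
  show "B (n + 4) 4 * ((1 - fps_X ^ 2) * (1 - fps_X ^ 3) * (1 - fps_X ^ 4)) =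
      (1 - fps_X ^ (n + 1)) * (1 - fps_X ^ (n + 2)) * (1 - fps_X ^ (n + 3)) * (1 - fps_X ^ (n + 4))"
    by (rule cancel, unfold B, insert ex[of 4])
      (simp add: S numeral_eq_Suc mult_ac del: power_Suc)
qed

section \<open>Partition counts\<close>

text \<open>Closed form of p_23: raising \<open>n\<close> by 6 adds one partition, and among 0, ...,
  5 only 1 has none. \<open>fps_parts23\<close> confirms it.\<close>

definition parts23 :: "nat \<Rightarrow> int" where
  "parts23 n = int (if n mod 6 = 1 then n div 6 else n div 6 + 1)"

text \<open>This is p_123, since the number of parts 1 is fixed by what the parts 2 and 3 leave
  over.\<close>

definition parts123 :: "nat \<Rightarrow> int" where
  "parts123 n = (\<Sum>i\<le>n. parts23 i)"

text \<open>
  In a partition of \<open>n\<close> into parts 2, 3, 4 the number of parts 3 has the parity of \<open>n\<close>;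
  removing one of them if \<open>n\<close> is odd and halving gives a partition into parts 1, 2, 3.
\<close>

definition parts234 :: "nat \<Rightarrow> int" where
  "parts234 n =
    (if even n then parts123 (n div 2) else if n = 1 then 0 else parts123 ((n - 3) div 2))"

lemma parts23_add: "parts23 (6 * q + r) = int q + parts23 r"
  by (simp add: parts23_def)

lemma mod6_cases:
  fixes n :: nat
  obtains q r where "n = 6 * q + r" "r \<in> {0, 1, 2, 3, 4, 5}"
proof
  show "n = 6 * (n div 6) + n mod 6" by simp
  have "n mod 6 < 6" by simp
  then show "n mod 6 \<in> {0, 1, 2, 3, 4, 5}" by auto
qed

lemma parts123_0 [simp]: "parts123 0 = 1"
  by (simp add: parts123_def parts23_def)

lemma parts123_Suc: "parts123 (Suc n) = parts123 n + parts23 (Suc n)"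
  by (simp add: parts123_def)

lemma parts23_nonneg: "0 \<le> parts23 n"
  by (simp add: parts23_def)

lemma parts123_mono: "i \<le> j \<Longrightarrow> parts123 i \<le> parts123 j"
  by (rule lift_Suc_mono_le) (simp_all add: parts123_Suc parts23_nonneg)

lemma parts123_pos: "0 < parts123 j"
  using parts123_mono[of 0 j] by simp

lemma parts23_pos:
  assumes "n \<noteq> 1"
  shows "0 < parts23 n"
proof -
  have "0 < n div 6" if "n mod 6 = 1" using that assms by presburger
  then show ?thesis by (auto simp: parts23_def)
qed

text \<open>\<open>parts23\<close> vanishes only at 1, so the single repeated value is
  \<open>parts123 0 = parts123 1\<close>. This repetition is what excludes \<open>m = 5\<close> for
  \<open>k = 4\<close>.\<close>

lemma parts123_strict_mono:
  assumes "i < j" "j \<noteq> 1"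
  shows "parts123 i < parts123 j"
proof -
  obtain l where "j = Suc l" using assms(1) by (cases j) auto
  then show ?thesis
    using parts123_mono[of i l] parts23_pos[OF assms(2)] assms(1) by (simp add: parts123_Suc)
qed

text \<open>All three of p_23(j+1) + p_23(j+2), p_23(2j+4) and p_23(2j+7) grow by 2 when
  \<open>j\<close> grows by 6, so six residues suffice. These are the recurrences of
  \<open>parts234\<close> with step 4, for even and odd arguments.\<close>

lemma parts123_Suc_Suc:
  "parts123 (Suc (Suc j)) = parts123 j + parts23 (2 * j + 4)"
  "parts123 (Suc (Suc j)) = parts123 j + parts23 (2 * j + 7)"
proof -
  obtain q r where j: "j = 6 * q + r" "r \<in> {0, 1, 2, 3, 4, 5}" by (rule mod6_cases)
  have "parts23 (Suc j) = int q + parts23 (r + 1)" "parts23 (Suc (Suc j)) = int q + parts23 (r + 2)"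
    using parts23_add[of q "r + 1"] parts23_add[of q "r + 2"] by (simp_all add: j(1))
  moreover have "parts23 (2 * j + 4) = 2 * int q + parts23 (2 * r + 4)"
    "parts23 (2 * j + 7) = 2 * int q + parts23 (2 * r + 7)"
    using parts23_add[of "2 * q" "2 * r + 4"] parts23_add[of "2 * q" "2 * r + 7"]
    by (simp_all add: j(1) algebra_simps)
  moreover have "parts23 (r + 1) + parts23 (r + 2) = parts23 (2 * r + 4)"
    "parts23 (2 * r + 4) = parts23 (2 * r + 7)"
    using j(2) by (auto simp: parts23_def)
  ultimately show "parts123 (Suc (Suc j)) = parts123 j + parts23 (2 * j + 4)"
    "parts123 (Suc (Suc j)) = parts123 j + parts23 (2 * j + 7)"
    by (simp_all add: parts123_Suc)
qed

section \<open>Generating functions of the partition counts\<close>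

lemma fps_even: "Abs_fps (\<lambda>n. if even n then 1 else 0 :: int) * (1 - fps_X ^ 2) = 1"
proof (rule fps_ext)
  fix n :: nat
  consider "n = 0" | "n = 1" | "2 \<le> n" by linarith
  then show "fps_nth (Abs_fps (\<lambda>n. if even n then 1 else 0 :: int) * (1 - fps_X ^ 2)) n = fps_nth 1 n"
    by cases (simp_all add: right_diff_distrib fps_X_power_mult_right_nth)
qed

text \<open>\<open>n div 2 + 1\<close> is p_12(n): the number of parts 2 ranges from 0 to
  \<open>n div 2\<close>.\<close>

lemma fps_half: "Abs_fps (\<lambda>n. int (n div 2 + 1)) * ((1 - fps_X) * (1 - fps_X ^ 2)) = 1"
proof -
  have "Abs_fps (\<lambda>n. int (n div 2 + 1)) * (1 - fps_X) = Abs_fps (\<lambda>n. if even n then 1 else 0)"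
  proof (rule fps_ext)
    fix n
    show "fps_nth (Abs_fps (\<lambda>n. int (n div 2 + 1)) * (1 - fps_X)) n =
        fps_nth (Abs_fps (\<lambda>n. if even n then 1 else 0)) n"
      by (cases n) (auto simp: right_diff_distrib)
  qed
  then show ?thesis using fps_even by (simp only: mult.assoc[symmetric])
qed

lemma fps_parts23: "Abs_fps parts23 * ((1 - fps_X ^ 2) * (1 - fps_X ^ 3)) = 1"
proof (rule fps_ext)
  fix n
  let ?F = "Abs_fps parts23"
  have "?F * ((1 - fps_X ^ 2) * (1 - fps_X ^ 3)) =
      ?F - fps_X ^ 2 * ?F - fps_X ^ 3 * ?F + fps_X ^ 5 * ?F"
    by (simp add: algebra_simps flip: power_add)
  moreover have "parts23 n - (if n < 2 then 0 else parts23 (n - 2))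
      - (if n < 3 then 0 else parts23 (n - 3)) + (if n < 5 then 0 else parts23 (n - 5)) =
      (if n = 0 then 1 else 0)"
  proof (cases "n < 5")
    case True
    then have "n = 0 \<or> n = 1 \<or> n = 2 \<or> n = 3 \<or> n = 4" by linarith
    then show ?thesis by (elim disjE) (simp_all add: parts23_def)
  next
    case False
    then have "n = (n - 5) + 5" by simp
    then obtain l where n: "n = l + 5" by blast
    obtain q r where l: "l = 6 * q + r" "r \<in> {0, 1, 2, 3, 4, 5}" by (rule mod6_cases)
    have "parts23 (l + 5) + parts23 l = parts23 (l + 3) + parts23 (l + 2)"
      unfolding l(1) add.assoc parts23_add using l(2)
      by (elim insertE emptyE; simp add: parts23_def)
    moreover have "n - 2 = l + 3" "n - 3 = l + 2" "n - 5 = l" by (simp_all add: n)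
    ultimately have "parts23 n + parts23 (n - 5) = parts23 (n - 2) + parts23 (n - 3)"
      using n by metis
    then show ?thesis using False by simp
  qed
  ultimately show "fps_nth (?F * ((1 - fps_X ^ 2) * (1 - fps_X ^ 3))) n = fps_nth 1 n"
    by (simp add: fps_X_power_mult_nth cong: if_cong split del: if_split)
qed

lemma fps_parts123: "Abs_fps parts123 * (1 - fps_X) = Abs_fps parts23"
proof (rule fps_ext)
  fix n
  show "fps_nth (Abs_fps parts123 * (1 - fps_X)) n = fps_nth (Abs_fps parts23) n"
    by (cases n) (auto simp: right_diff_distrib parts123_Suc parts23_def)
qed

lemma fps_parts234: "Abs_fps parts234 * (1 - fps_X ^ 4) = Abs_fps parts23"
proof (rule fps_ext)
  fix n
  have "parts234 n - (if n < 4 then 0 else parts234 (n - 4)) = parts23 n"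
  proof (cases "n < 6")
    case True
    have small: "parts123 (Suc 0) = 1" "parts123 2 = 2"
      by (simp_all add: parts123_Suc parts23_def numeral_2_eq_2)
    from True have "n = 0 \<or> n = 1 \<or> n = 2 \<or> n = 3 \<or> n = 4 \<or> n = 5" by linarith
    then show ?thesis 
      by (elim disjE) (simp_all add: parts234_def parts23_def small)
  next
    case False
    \<comment> \<open>The bound 6 keeps \<open>n - 4\<close> away from the exceptional argument 1 of
      \<open>parts234\<close>.\<close>
    then have "n = 2 * (n div 2 - 2) + 4 \<or> n = 2 * (n div 2 - 3) + 7" by presburger
    then obtain j where "n = 2 * j + 4 \<or> n = 2 * j + 7" by blast
    then show ?thesis
    proof
      assume n: "n = 2 * j + 4"
      then have "n div 2 = Suc (Suc j)" "(n - 4) div 2 = j" by auto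
      then show ?thesis using parts123_Suc_Suc(1)[of j] n by (simp add: parts234_def)
    next
      assume n: "n = 2 * j + 7"
      then have "(n - 3) div 2 = Suc (Suc j)" "(n - 4 - 3) div 2 = j" by auto
      then show ?thesis using parts123_Suc_Suc(2)[of j] n by (simp add: parts234_def)
    qed
  qed
  then show "fps_nth (Abs_fps parts234 * (1 - fps_X ^ 4)) n = fps_nth (Abs_fps parts23) n"
    by (simp add: right_diff_distrib fps_X_power_mult_right_nth cong: if_cong split del: if_split)
qed

section \<open>First differences of q-binomials in low degrees\<close>

lemma qbinomial_step_fps:
  "qbinomial_step m k i = fps_nth (fps_of_poly ((1 - monom 1 1) * qbinomial m k)) i"
  by (simp add: qbinomial_step_def)

lemma qbinomial_step_0: "qbinomial_step n 0 0 = 1"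
  unfolding qbinomial_step_fps fps_one_minus_q_qbinomial by simp

lemma qbinomial_step_1: "i \<le> n \<Longrightarrow> qbinomial_step (n + 1) 1 i = (if i = 0 then 1 else 0)"
  unfolding qbinomial_step_fps fps_one_minus_q_qbinomial
  by (auto simp: fps_X_power_iff simp del: power_Suc)

lemma qbinomial_step_2:
  assumes "i \<le> n"
  shows "qbinomial_step (n + 2) 2 i = (if even i then 1 else 0)"
proof -
  define A where "A = fps_of_poly ((1 - monom 1 1) * qbinomial (n + 2) 2)"
  define E where "E = Abs_fps (\<lambda>n. if even n then 1 else 0 :: int)"
  define Y where "Y = (fps_X :: int fps) ^ (n + 1)"
  have E: "E * (1 - fps_X ^ 2) = 1" unfolding E_def by (rule fps_even)
  have "A * (1 - fps_X ^ 2) = (1 - Y) * (1 - fps_X * Y)"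
    using fps_one_minus_q_qbinomial(3)[of n] by (simp add: A_def Y_def)
  \<comment> \<open>Every term containing \<open>Y\<close> starts in degree \<open>n + 1\<close> or
    later, beyond \<open>i\<close>.\<close>
  then have "A = E - Y * ((1 + fps_X - fps_X * Y) * E)" using E by algebra
  then have "fps_nth A i = fps_nth E i"
    using assms unfolding Y_def by (simp only: fps_sub_nth fps_X_power_mult_nth) simp
  then show ?thesis by (simp add: qbinomial_step_fps A_def E_def)
qed

text \<open>The numerator is 1 - Y(1+x+x^2) up to terms divisible by x Y^2 = x^(2n+3), whence the
  bound on \<open>i\<close>. The factor 1+x+x^2 turns the denominator (1-x^2)(1-x^3) into
  (1-x)(1-x^2), so p_23 becomes p_12.\<close>

lemma qbinomial_step_3:
  assumes "i < 2 * n + 3"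
  shows "qbinomial_step (n + 3) 3 i =
    parts23 i - (if n < i then int ((i - (n + 1)) div 2 + 1) else 0)"
proof -
  define A where "A = fps_of_poly ((1 - monom 1 1) * qbinomial (n + 3) 3)"
  define G where "G = Abs_fps parts23"
  define H where "H = Abs_fps (\<lambda>n. int (n div 2 + 1))"
  define x where "x = (fps_X :: int fps)"
  define Y where "Y = x ^ (n + 1)"
  have G: "G * ((1 - x ^ 2) * (1 - x ^ 3)) = 1" unfolding G_def x_def by (rule fps_parts23)
  have H: "H * ((1 - x) * (1 - x ^ 2)) = 1" unfolding H_def x_def by (rule fps_half)
  have GH: "(1 + x + x ^ 2) * G = H" using G H by algebra
  have "A * ((1 - x ^ 2) * (1 - x ^ 3)) = (1 - Y) * (1 - x * Y) * (1 - x ^ 2 * Y)"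
    using fps_one_minus_q_qbinomial(4)[of n]
    by (simp add: A_def Y_def x_def numeral_eq_Suc mult_ac)
  then have "A = G - Y * H + x * Y ^ 2 * ((1 + x + x ^ 2 - x ^ 2 * Y) * G)" using G GH by algebra
  moreover have "x * Y ^ 2 = fps_X ^ (2 * n + 3)"
    unfolding Y_def x_def by (simp add: power_mult[symmetric] numeral_eq_Suc flip: power_add)
  ultimately have "A = G - fps_X ^ (n + 1) * H + fps_X ^ (2 * n + 3) * ((1 + x + x ^ 2 - x ^ 2 * Y) * G)"
    by (simp only: Y_def x_def)
  then have "fps_nth A i = fps_nth G i - (if n < i then fps_nth H (i - (n + 1)) else 0)"
    using assms by (simp only: fps_add_nth fps_sub_nth fps_X_power_mult_nth) auto
  then show ?thesis by (simp add: qbinomial_step_fps A_def G_def H_def)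
qed

text \<open>As for 3, with 1+x+x^2+x^3 = (1-x^4)/(1-x) replacing the parts 4 by parts 1, so p_234
  becomes p_123.\<close>

lemma qbinomial_step_4:
  assumes "i < 2 * n + 3"
  shows "qbinomial_step (n + 4) 4 i =
    parts234 i - (if n < i then parts123 (i - (n + 1)) else 0)"
proof -
  define A where "A = fps_of_poly ((1 - monom 1 1) * qbinomial (n + 4) 4)"
  define G where "G = Abs_fps parts234"
  define H where "H = Abs_fps parts123"
  define x where "x = (fps_X :: int fps)"
  define Y where "Y = x ^ (n + 1)"
  \<comment> \<open>The terms of the numerator of order at least 2 in \<open>Y\<close>, divided by x
    Y^2.\<close>
  define R where "R = ((1 + x + 2 * x ^ 2 + x ^ 3 + x ^ 4)
    - Y * x ^ 2 * (1 + x + x ^ 2 + x ^ 3) + x ^ 5 * Y ^ 2) * G"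
  have G23: "G * (1 - x ^ 4) = Abs_fps parts23" unfolding G_def x_def by (rule fps_parts234)
  then have GH4: "G * (1 - x ^ 4) = H * (1 - x)" unfolding H_def x_def by (simp add: fps_parts123)
  have G: "G * ((1 - x ^ 2) * (1 - x ^ 3) * (1 - x ^ 4)) = 1"
    using fps_parts23 unfolding G23[symmetric] x_def by (simp only: mult_ac)
  have "1 - x \<noteq> 0" unfolding x_def by (metis fps_X_neq_one right_minus_eq)
  moreover have "((1 + x + x ^ 2 + x ^ 3) * G) * (1 - x) = H * (1 - x)" using GH4 by algebra
  ultimately have GH: "(1 + x + x ^ 2 + x ^ 3) * G = H" by simp
  have "A * ((1 - x ^ 2) * (1 - x ^ 3) * (1 - x ^ 4)) =
      (1 - Y) * (1 - x * Y) * (1 - x ^ 2 * Y) * (1 - x ^ 3 * Y)"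
    using fps_one_minus_q_qbinomial(5)[of n]
    by (simp add: A_def Y_def x_def numeral_eq_Suc mult_ac)
  then have "A = ((1 - Y) * (1 - x * Y) * (1 - x ^ 2 * Y) * (1 - x ^ 3 * Y)) * G"
    using G by algebra
  also have "\<dots> = G - Y * ((1 + x + x ^ 2 + x ^ 3) * G) + x * Y ^ 2 * R"
    unfolding R_def by algebra
  also have "x * Y ^ 2 = fps_X ^ (2 * n + 3)"
    unfolding Y_def x_def by (simp add: power_mult[symmetric] numeral_eq_Suc flip: power_add)
  finally have "A = G - fps_X ^ (n + 1) * H + fps_X ^ (2 * n + 3) * R"
    unfolding GH by (simp only: Y_def x_def)
  then have "fps_nth A i = fps_nth G i - (if n < i then fps_nth H (i - (n + 1)) else 0)"
    using assms by (simp only: fps_add_nth fps_sub_nth fps_X_power_mult_nth) auto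
  then show ?thesis by (simp add: qbinomial_step_fps A_def G_def H_def)
qed

section \<open>The case k = 2\<close>

text \<open>The first differences are 1, 0, 1, 0, ... up to the middle degree \<open>m - 2\<close>,
  and the subtracted monomial takes 1 away exactly there.\<close>

lemma f_poly_2:
  assumes adm: "admissible 2 m b"
  shows "nonnegative_poly (f_poly 2 m b) \<and> unimodal_poly (f_poly 2 m b) \<longleftrightarrow> even m"
proof -
  obtain n where m: "m = n + 2" using adm by (auto simp: admissible_def dest: le_Suc_ex)
  have e: "f_exponent 2 m b = int n" by (simp add: f_exponent_def m)
  have "nonnegative_poly (f_poly 2 m b) \<and> unimodal_poly (f_poly 2 m b) \<longleftrightarrow>
      (\<forall>i\<le>n. (if i = n then 1 else 0) \<le> (if even i then 1 else 0 :: int))"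
    unfolding f_poly_nonneg_unimodal_iff[OF adm e]
    by (rule all_cong1) (auto simp: m qbinomial_step_0 qbinomial_step_2 simp del: add_2_eq_Suc')
  then show ?thesis by (auto simp: m)
qed

section \<open>The case k = 3\<close>

text \<open>As \<open>n\<close> is at least 2i/3, the left side is about i/6, like
  \<open>parts23 i\<close>; the rounding is settled modulo 6.\<close>

lemma parts23_le:
  assumes "2 * i \<le> 3 * n" "n < i"
  shows "int ((i - (n + 1)) div 2 + 1) \<le> parts23 i"
proof -
  obtain q r where i: "i = 6 * q + r" "r \<in> {0, 1, 2, 3, 4, 5}" by (rule mod6_cases)
  have "(i - (n + 1)) div 2 + 1 \<le> q + (if r < 3 then 0 else 1)"
    using i assms by auto
  also have "int \<dots> \<le> parts23 i"
    unfolding i(1) parts23_add using i(2) by (auto simp: parts23_def)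
  finally show ?thesis by simp
qed

text \<open>Decides whether the first difference of \<open>qbinomial (n + 3) 3\<close> at
  \<open>e\<close> is positive. Apart from \<open>e = 1\<close>, it vanishes only close to the
  middle, that is for small \<open>b\<close>.\<close>

lemma parts23_less_iff:
  assumes "2 * e + b = 3 * n + 1" "0 < b"
  shows "(if n < e then int ((e - (n + 1)) div 2 + 1) else 0) < parts23 e \<longleftrightarrow>
    e \<noteq> 1 \<and> (odd n \<longrightarrow> b \<noteq> 2) \<and> (n mod 4 = 2 \<longrightarrow> b \<noteq> 1 \<and> b \<noteq> 5) \<and> (n mod 4 = 0 \<longrightarrow> b \<noteq> 3)"
proof (cases "n < e")
  case False
  \<comment> \<open>Here \<open>b\<close> is at least \<open>n + 1\<close>, so an exceptional
    \<open>b\<close> leaves only \<open>n\<close> = 0, 1 or 2; the first contradicts the equation,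
    the others force \<open>e = 1\<close>.\<close>
  have "b \<noteq> 2" if "e \<noteq> 1" "odd n" using that assms False by (auto elim!: oddE)
  moreover have "b \<noteq> 1 \<and> b \<noteq> 5" if "e \<noteq> 1" "n mod 4 = 2"
  proof -
    have "n = 4 * (n div 4) + 2" using that(2) by presburger
    then obtain l where "n = 4 * l + 2" by blast
    then show ?thesis using that(1) assms False by presburger
  qed
  moreover have "b \<noteq> 3" if "n mod 4 = 0"
  proof -
    have "n = 4 * (n div 4)" using that by presburger
    then show ?thesis using assms False by auto
  qed
  moreover have "0 < parts23 e \<longleftrightarrow> e \<noteq> 1" using parts23_pos[of e] by (auto simp: parts23_def)
  ultimately show ?thesis using False by auto
next
  case True
  obtain q r where e: "e = 6 * q + r" and r: "r \<in> {0, 1, 2, 3, 4, 5}" by (rule mod6_cases)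
  define u where "u = (e - n) div 2"
  define v where "v = (e - n) mod 2"
  have v: "v \<in> {0, 1}" by (auto simp: v_def)
  have uv: "e = n + (2 * u + v)" using True by (simp add: u_def v_def)
  \<comment> \<open>As \<open>b\<close> is positive, \<open>2 * e\<close> is at most
    \<open>3 * n\<close>, so 6u <= 3(e-n) <= e.\<close>
  have "u \<le> q" using assms uv e r v by auto
  then obtain w where w: "q = u + w" by (metis le_Suc_ex)
  have n: "n + v = 4 * u + (6 * w + r)" and b: "b + 3 * v = 6 * w + r + 1"
    using assms uv e w by simp_all
  have "(e - (n + 1)) div 2 + 1 = u + v" using uv v True by auto
  then have "(if n < e then int ((e - (n + 1)) div 2 + 1) else 0) < parts23 e \<longleftrightarrow>
      int v < int w + parts23 r"
    unfolding e parts23_add using True by (simp add: e w)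
  \<comment> \<open>The inequality fails exactly for (w,v,r) = (0,0,1), (0,1,3), (0,1,4), (0,1,5),
    (1,1,1), where \<open>b\<close> = 2, 1, 2, 3, 5 and \<open>n\<close> is 1, 2, 3, 0, 2 modulo 4.
    The triples (0,1,r) with r < 3 would make \<open>b\<close> nonpositive.\<close>
  also have "\<dots> \<longleftrightarrow> e \<noteq> 1 \<and> (odd n \<longrightarrow> b \<noteq> 2) \<and> (n mod 4 = 2 \<longrightarrow> b \<noteq> 1 \<and> b \<noteq> 5) \<and>
      (n mod 4 = 0 \<longrightarrow> b \<noteq> 3)"
  proof -
    consider "w = 0" | "w = 1" | "2 \<le> w" by linarith
    then show ?thesis
    proof cases
      case 3
      then have "int v < int w + parts23 r" using v parts23_nonneg[of r] by auto
      moreover have "10 \<le> b + 3 * v - 3" "e \<noteq> 1" using 3 b e w by auto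
      ultimately show ?thesis using v by auto
    next
      case 1
      then have e1: "e \<noteq> 1" using True uv e w n b by linarith
      from v consider "v = 0" | "v = 1" by blast
      then show ?thesis
      proof cases
        case 1
        then have "n = 4 * u + r" "b = r + 1" using n b \<open>w = 0\<close> by simp_all
        with r \<open>v = 0\<close> \<open>w = 0\<close> e1 show ?thesis
          by (elim insertE emptyE) (simp_all add: parts23_def del: add_2_eq_Suc')
      next
        case 2
        then have "n = 4 * u + (r - 1)" "b = r - 2" "3 \<le> r"
          using n b \<open>w = 0\<close> assms(2) by linarith+
        with r \<open>v = 1\<close> \<open>w = 0\<close> e1 show ?thesis
          by (elim insertE emptyE) (simp_all add: parts23_def del: add_2_eq_Suc')
      qed
    next
      case 2
      then have e1: "e \<noteq> 1" using e w by simp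
      from v consider "v = 0" | "v = 1" by blast
      then show ?thesis
      proof cases
        case 1
        then have "n = 4 * u + (r + 6)" "b = r + 7" using n b \<open>w = 1\<close> by simp_all
        with r \<open>v = 0\<close> \<open>w = 1\<close> e1 show ?thesis
          by (elim insertE emptyE) (simp_all add: parts23_def del: add_2_eq_Suc')
      next
        case 2
        then have "n = 4 * u + (r + 5)" "b = r + 4" using n b \<open>w = 1\<close> by simp_all
        with r \<open>v = 1\<close> \<open>w = 1\<close> e1 show ?thesis
          by (elim insertE emptyE) (simp_all add: parts23_def del: add_2_eq_Suc')
      qed
    qed
  qed
  finally show ?thesis .
qed

lemma f_poly_3:
  assumes adm: "admissible 3 m b"
  shows "nonnegative_poly (f_poly 3 m b) \<and> unimodal_poly (f_poly 3 m b) \<longleftrightarrow>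
    int b \<noteq> 3 * int m - 10 \<and> (even m \<longrightarrow> b \<noteq> 2) \<and>
    (m mod 4 = 1 \<longrightarrow> b \<noteq> 1 \<and> b \<noteq> 5) \<and> (m mod 4 = 3 \<longrightarrow> b \<noteq> 3)"
proof -
  obtain n where m: "m = n + 3" using adm by (auto simp: admissible_def dest: le_Suc_ex)
  obtain c where b: "b = c + 1" using adm by (auto simp: admissible_def dest: le_Suc_ex)
  obtain e where e: "f_exponent 3 m b = int e"
    using f_exponent_nonneg(1)[OF adm] by (metis nonneg_int_cases)
  have eb: "2 * e + b = 3 * n + 1"
    using f_exponent_nonneg(2)[OF adm] unfolding e by (simp add: m)
  let ?s = "\<lambda>i. if n < i then int ((i - (n + 1)) div 2 + 1) else 0"
  have "nonnegative_poly (f_poly 3 m b) \<and> unimodal_poly (f_poly 3 m b) \<longleftrightarrow>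
      (\<forall>i. 2 * i \<le> 3 * n \<longrightarrow> (if i = e then 1 else 0) \<le> parts23 i - ?s i)"
    unfolding f_poly_nonneg_unimodal_iff[OF adm e]
  proof (rule all_cong1)
    fix i
    \<comment> \<open>Both terms of f share their centre, so \<open>i - e\<close> is at most half
      the degree \<open>c\<close> of \<open>qbinomial b 1\<close>.\<close>
    have "qbinomial_step b 1 (i - e) = (if i - e = 0 then 1 else 0)" if "2 * i \<le> 3 * n"
      unfolding b using that eb b by (intro qbinomial_step_1) linarith
    moreover have "qbinomial_step m 3 i = parts23 i - ?s i" if "2 * i \<le> 3 * n"
      unfolding m using that by (intro qbinomial_step_3) linarith
    ultimately show "(2 * i \<le> 3 * (m - 3) \<longrightarrow>
        (if e \<le> i then qbinomial_step b (3 - 2) (i - e) else 0) \<le> qbinomial_step m 3 i) \<longleftrightarrow>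
        (2 * i \<le> 3 * n \<longrightarrow> (if i = e then 1 else 0) \<le> parts23 i - ?s i)"
      by (auto simp: m)
  qed
  also have "\<dots> \<longleftrightarrow> ?s e < parts23 e"
  proof
    assume "\<forall>i. 2 * i \<le> 3 * n \<longrightarrow> (if i = e then 1 else 0) \<le> parts23 i - ?s i"
    moreover have "2 * e \<le> 3 * n" using eb b by linarith
    ultimately have "1 \<le> parts23 e - ?s e" by metis
    then show "?s e < parts23 e" by linarith
  next
    assume "?s e < parts23 e"
    moreover have "?s i \<le> parts23 i" if "2 * i \<le> 3 * n" for i
      using parts23_le[OF that] parts23_nonneg[of i] by simp
    ultimately show "\<forall>i. 2 * i \<le> 3 * n \<longrightarrow> (if i = e then 1 else 0) \<le> parts23 i - ?s i"
      by fastforce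
  qed
  also have "\<dots> \<longleftrightarrow> int b \<noteq> 3 * int m - 10 \<and> (even m \<longrightarrow> b \<noteq> 2) \<and>
    (m mod 4 = 1 \<longrightarrow> b \<noteq> 1 \<and> b \<noteq> 5) \<and> (m mod 4 = 3 \<longrightarrow> b \<noteq> 3)"
  proof -
    have "int b \<noteq> 3 * int m - 10 \<longleftrightarrow> e \<noteq> 1" using eb m by linarith
    moreover have "m mod 4 = 1 \<longleftrightarrow> n mod 4 = 2" "m mod 4 = 3 \<longleftrightarrow> n mod 4 = 0" "even m \<longleftrightarrow> odd n"
      unfolding m by presburger+
    ultimately show ?thesis using parts23_less_iff[OF eb] b by simp
  qed
  finally show ?thesis .
qed

section \<open>The case k = 4\<close>

text \<open>The subtracted term takes 1 from the differences at e, e+2, ... up to the middle, and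
  \<open>e\<close> has the parity of \<open>b\<close>. Even indices have a positive difference to
  spare unless \<open>m = 5\<close>, whereas the last odd index before the middle has none.\<close>

lemma f_poly_4:
  assumes adm: "admissible 4 m b"
  shows "nonnegative_poly (f_poly 4 m b) \<and> unimodal_poly (f_poly 4 m b) \<longleftrightarrow> even b \<and> m \<noteq> 5"
proof -
  obtain n where m: "m = n + 4" using adm by (auto simp: admissible_def dest: le_Suc_ex)
  have "2 \<le> b" using adm by (auto simp: admissible_def)
  then obtain c where b: "b = c + 2" by (metis add.commute le_Suc_ex)
  obtain e where e: "f_exponent 4 m b = int e"
    using f_exponent_nonneg(1)[OF adm] by (metis nonneg_int_cases)
  have eb: "e + c = 2 * n" 
    using f_exponent_nonneg(2)[OF adm] unfolding e by (simp add: m b)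
  let ?d = "\<lambda>i. parts234 i - (if n < i then parts123 (i - (n + 1)) else 0)"
  have iff: "nonnegative_poly (f_poly 4 m b) \<and> unimodal_poly (f_poly 4 m b) \<longleftrightarrow>
      (\<forall>i\<le>2 * n. (if e \<le> i \<and> even (i - e) then 1 else 0) \<le> ?d i)"
    unfolding f_poly_nonneg_unimodal_iff[OF adm e]
  proof (rule all_cong1)
    fix i
    have "qbinomial_step b 2 (i - e) = (if even (i - e) then 1 else 0)" if "i \<le> 2 * n"
      unfolding b using that eb by (intro qbinomial_step_2) linarith
    moreover have "qbinomial_step m 4 i = ?d i" if "i \<le> 2 * n"
      unfolding m using that by (intro qbinomial_step_4) linarith
    ultimately show "(2 * i \<le> 4 * (m - 4) \<longrightarrow>
        (if e \<le> i then qbinomial_step b (4 - 2) (i - e) else 0) \<le> qbinomial_step m 4 i) \<longleftrightarrow>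
        (i \<le> 2 * n \<longrightarrow> (if e \<le> i \<and> even (i - e) then 1 else 0) \<le> ?d i)"
      by (auto simp: m)
  qed
  show ?thesis
    unfolding iff
  proof
    assume L: "\<forall>i\<le>2 * n. (if e \<le> i \<and> even (i - e) then 1 else 0) \<le> ?d i"
    show "even b \<and> m \<noteq> 5"
    proof (rule ccontr)
      assume "\<not> (even b \<and> m \<noteq> 5)"
      then consider "odd c" | "even c" "n = 1" by (auto simp: b m)
      then show False
      proof cases
        case 1
        then have c: "0 < c" and n: "0 < n" using eb odd_pos by (auto intro: gr0I)
        \<comment> \<open>At \<open>2 * n - 1\<close> both partition counts equal p_123(n-2), or are
          0 if \<open>n = 1\<close>.\<close>
        have "2 * n - 1 - e = c - 1" "e \<le> 2 * n - 1" using eb c by auto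
        then have "1 \<le> ?d (2 * n - 1)" using L[rule_format, of "2 * n - 1"] 1 c by simp
        moreover have "?d (2 * n - 1) = 0"
        proof (cases "n = 1")
          case True
          then show ?thesis by (simp add: parts234_def)
        next
          case False
          with n have "2 * n - 1 - 3 = 2 * (n - 2)" "2 * n - 1 - (n + 1) = n - 2" "n < 2 * n - 1"
            "odd (2 * n - 1)" "2 * n - 1 \<noteq> 1" by auto
          then show ?thesis by (simp add: parts234_def)
        qed
        ultimately show False by simp
      next
        case 2
        \<comment> \<open>For \<open>n = 1\<close> the middle index 2 has difference p_123(1) -
          p_123(0) = 0.\<close>
        then have "2 - e = c" "e \<le> 2" using eb by auto
        then have "1 \<le> ?d 2" using L[rule_format, of 2] 2 by simp
        then show False using 2 by (simp add: parts234_def parts123_Suc parts23_def)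
      qed
    qed
  next
    assume R: "even b \<and> m \<noteq> 5"
    then have ev: "even e" and n1: "n \<noteq> 1" using eb b m by (auto, presburger)
    show "\<forall>i\<le>2 * n. (if e \<le> i \<and> even (i - e) then 1 else 0) \<le> ?d i"
    proof (intro allI impI)
      fix i
      assume i: "i \<le> 2 * n"
      show "(if e \<le> i \<and> even (i - e) then 1 else 0) \<le> ?d i"
      proof (cases "even i")
        case True
        then obtain j where j: "i = 2 * j" by blast
        \<comment> \<open>From j <= n follows 2j-n-1 < j; the exception j = 1 would need
          \<open>n = 1\<close>.\<close>
        have "parts123 (i - (n + 1)) < parts123 j" if "n < i"
          using that i j n1 by (intro parts123_strict_mono) auto
        then have "1 \<le> ?d i" using parts123_pos[of j] by (auto simp: j parts234_def)
        then show ?thesis by simp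
      next
        case False
        then have "\<not> (e \<le> i \<and> even (i - e))" using ev by auto
        moreover have "0 \<le> ?d i"
        proof (cases "i = 1")
          case True
          then show ?thesis using i by (simp add: parts234_def)
        next
          case False
          with \<open>odd i\<close> have "i = 2 * ((i - 3) div 2) + 3" by presburger
          then obtain j where j: "i = 2 * j + 3" by blast
          \<comment> \<open>An odd \<open>i\<close> is at most 2n-1, so j <= n-2 and 2j+2-n <=
            j.\<close>
          have "parts123 (i - (n + 1)) \<le> parts123 j"
            using i j by (intro parts123_mono) linarith
          then show ?thesis using parts123_pos[of j] by (simp add: j parts234_def)
        qed
        ultimately show ?thesis by (simp only: if_False)
      qed
    qed
  qed
qed

theorem theorem2p2:
  fixes k m b :: nat
  assumes "admissible k m b"
  shows "(k = 2 \<longrightarrow>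
           (nonnegative_poly (f_poly k m b) \<and> unimodal_poly (f_poly k m b) \<longleftrightarrow> even m)) \<and>
         (k = 3 \<longrightarrow>
           (nonnegative_poly (f_poly k m b) \<and> unimodal_poly (f_poly k m b) \<longleftrightarrow>
              int b \<noteq> 3 * int m - 10 \<and>
              (even m \<longrightarrow> b \<noteq> 2) \<and>
              (m mod 4 = 1 \<longrightarrow> b \<noteq> 1 \<and> b \<noteq> 5) \<and>
              (m mod 4 = 3 \<longrightarrow> b \<noteq> 3))) \<and>
         (k = 4 \<longrightarrow>
           (nonnegative_poly (f_poly k m b) \<and> unimodal_poly (f_poly k m b) \<longleftrightarrow>
              even b \<and> m \<noteq> 5))"
  using assms f_poly_2[of m b] f_poly_3[of m b] f_poly_4[of m b] by blast

end
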